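(* Let $\mathbb{H}=(-1,-1)_{\mathbb{R}}$ be the Hamiltonian division algebra over $\mathbb{R}$ with the orthogonal involution $\sigma=\mathrm{Int}(i)\circ\gamma$. Then the involution $\sigma$ is anisotropic but weakly isotropic.
   Context: $(a,b)_F$ denotes the quaternion algebra over $F$ generated by $i,j$ with $i^2=a$, $j^2=b$, $ij=-ji$; put $k=ij$. Its canonical involution is $\gamma(x_0+x_1i+x_2j+x_3k)=x_0-x_1i-x_2j-x_3k$. $\mathrm{Int}(i)$ is the inner automorphism $x\mapsto i x i^{-1}$. An involution $\sigma$ on $A$ is isotropic if there is a nonzero $x\in A$ with $\sigma(x)x=0$, and anisotropic otherwise; it is weakly isotropic if there exist $n\ge 1$ and nonzero $x_1,\dots,x_n\in A$ with $\sum_{i=1}^n\sigma(x_i)x_i=0$. *)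

theory Defs
  imports Complex_Main "HOL-Algebra.Embedded_Algebras"
begin

section \<open>Quaternion algebras\<close>

text \<open>\<open>Quat x\<^sub>0 x\<^sub>1 x\<^sub>2 x\<^sub>3\<close> stands for \<open>x\<^sub>0 + x\<^sub>1 i + x\<^sub>2 j + x\<^sub>3 k\<close>, where \<open>k = ij\<close>.\<close>

datatype 'a quat = Quat 'a 'a 'a 'a

abbreviation quat_scalar :: "'a::field \<Rightarrow> 'a quat" where "quat_scalar c \<equiv> Quat c 0 0 0"
abbreviation quat_i :: "'a::field quat" where "quat_i \<equiv> Quat 0 1 0 0"
abbreviation quat_j :: "'a::field quat" where "quat_j \<equiv> Quat 0 0 1 0"
abbreviation quat_k :: "'a::field quat" where "quat_k \<equiv> Quat 0 0 0 1"

fun quat_add :: "'a::field quat \<Rightarrow> 'a quat \<Rightarrow> 'a quat" where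
  "quat_add (Quat x0 x1 x2 x3) (Quat y0 y1 y2 y3) =
     Quat (x0 + y0) (x1 + y1) (x2 + y2) (x3 + y3)"

text \<open>The bilinear multiplication determined by \<open>i\<^sup>2 = a\<close>, \<open>j\<^sup>2 = b\<close> and \<open>ij = -ji = k\<close>; these
  relations force \<open>k\<^sup>2 = -ab\<close>, \<open>ik = -ki = aj\<close> and \<open>kj = -jk = bi\<close>.  The result is a
  quaternion algebra in the usual sense when \<open>a\<close> and \<open>b\<close> are nonzero and the characteristic is
  not 2.\<close>

fun quat_mult :: "'a::field \<Rightarrow> 'a \<Rightarrow> 'a quat \<Rightarrow> 'a quat \<Rightarrow> 'a quat" where
  "quat_mult a b (Quat x0 x1 x2 x3) (Quat y0 y1 y2 y3) =
     Quat (x0 * y0 + a * x1 * y1 + b * x2 * y2 - a * b * x3 * y3)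
          (x0 * y1 + x1 * y0 - b * x2 * y3 + b * x3 * y2)
          (x0 * y2 + x2 * y0 + a * x1 * y3 - a * x3 * y1)
          (x0 * y3 + x3 * y0 + x1 * y2 - x2 * y1)"

definition quaternion_algebra :: "'a::field \<Rightarrow> 'a \<Rightarrow> 'a quat ring" where
  "quaternion_algebra a b =
     \<lparr>carrier = UNIV, mult = quat_mult a b, one = quat_scalar 1,
      zero = quat_scalar 0, add = quat_add\<rparr>"

fun quat_conj :: "'a::field quat \<Rightarrow> 'a quat" where
  "quat_conj (Quat x0 x1 x2 x3) = Quat x0 (- x1) (- x2) (- x3)"

definition hamilton_quaternions :: "real quat ring" (\<open>\<bbbH>\<close>) where
  "\<bbbH> = quaternion_algebra (-1) (-1)"


section \<open>Involutions\<close>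

definition inner_automorphism :: "('a, 'b) ring_scheme \<Rightarrow> 'a \<Rightarrow> 'a \<Rightarrow> 'a" where
  "inner_automorphism A u x = u \<otimes>\<^bsub>A\<^esub> x \<otimes>\<^bsub>A\<^esub> inv\<^bsub>A\<^esub> u"

definition involution :: "('a, 'b) ring_scheme \<Rightarrow> ('a \<Rightarrow> 'a) \<Rightarrow> bool" where
  "involution A \<sigma> \<longleftrightarrow>
     \<sigma> \<in> carrier A \<rightarrow> carrier A \<and>
     (\<forall>x\<in>carrier A. \<forall>y\<in>carrier A. \<sigma> (x \<oplus>\<^bsub>A\<^esub> y) = \<sigma> x \<oplus>\<^bsub>A\<^esub> \<sigma> y) \<and>
     (\<forall>x\<in>carrier A. \<forall>y\<in>carrier A. \<sigma> (x \<otimes>\<^bsub>A\<^esub> y) = \<sigma> y \<otimes>\<^bsub>A\<^esub> \<sigma> x) \<and>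
     (\<forall>x\<in>carrier A. \<sigma> (\<sigma> x) = x)"

text \<open>For a central simple algebra \<open>A\<close> of degree \<open>n\<close> (so of dimension \<open>n\<^sup>2\<close>) over a field \<open>K\<close> of
  characteristic different from 2, an involution fixing \<open>K\<close> is orthogonal if its symmetric elements
  form a space of dimension \<open>n (n + 1) / 2\<close>.  The definition is meant only for this situation;
  \<open>K\<close> is identified with its image in \<open>A\<close>.\<close>

definition orthogonal_involution :: "'a set \<Rightarrow> ('a, 'b) ring_scheme \<Rightarrow> ('a \<Rightarrow> 'a) \<Rightarrow> bool" where
  "orthogonal_involution K A \<sigma> \<longleftrightarrow>
     involution A \<sigma> \<and> (\<forall>c\<in>K. \<sigma> c = c) \<and>
     (\<exists>n. ring.dimension A (n ^ 2) K (carrier A) \<and>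
          ring.dimension A (n * (n + 1) div 2) K {x \<in> carrier A. \<sigma> x = x})"

definition isotropic :: "('a, 'b) ring_scheme \<Rightarrow> ('a \<Rightarrow> 'a) \<Rightarrow> bool" where
  "isotropic A \<sigma> \<longleftrightarrow> (\<exists>x\<in>carrier A. x \<noteq> \<zero>\<^bsub>A\<^esub> \<and> \<sigma> x \<otimes>\<^bsub>A\<^esub> x = \<zero>\<^bsub>A\<^esub>)"

abbreviation anisotropic :: "('a, 'b) ring_scheme \<Rightarrow> ('a \<Rightarrow> 'a) \<Rightarrow> bool" where
  "anisotropic A \<sigma> \<equiv> \<not> isotropic A \<sigma>"

definition weakly_isotropic :: "('a, 'b) ring_scheme \<Rightarrow> ('a \<Rightarrow> 'a) \<Rightarrow> bool" where
  "weakly_isotropic A \<sigma> \<longleftrightarrow>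
     (\<exists>n\<ge>1. \<exists>x :: nat \<Rightarrow> 'a.
        (\<forall>i\<in>{1..n}. x i \<in> carrier A \<and> x i \<noteq> \<zero>\<^bsub>A\<^esub>) \<and>
        (\<Oplus>\<^bsub>A\<^esub>i\<in>{1..n}. \<sigma> (x i) \<otimes>\<^bsub>A\<^esub> x i) = \<zero>\<^bsub>A\<^esub>)"


section \<open>Basic facts\<close>

lemma quaternion_algebra_simps [simp]:
  "carrier (quaternion_algebra a b) = UNIV"
  "mult (quaternion_algebra a b) = quat_mult a b"
  "one (quaternion_algebra a b) = quat_scalar 1"
  "zero (quaternion_algebra a b) = quat_scalar 0"
  "add (quaternion_algebra a b) = quat_add"
  by (simp_all add: quaternion_algebra_def)

lemma ring_quaternion_algebra: "ring (quaternion_algebra a b)"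
proof (rule ringI)
  show "abelian_group (quaternion_algebra a b)"
  proof (rule abelian_groupI)
    fix x assume "x \<in> carrier (quaternion_algebra a b)"
    show "\<exists>y\<in>carrier (quaternion_algebra a b).
            y \<oplus>\<^bsub>quaternion_algebra a b\<^esub> x = \<zero>\<^bsub>quaternion_algebra a b\<^esub>"
      by (cases x) (auto intro: exI[of _ "Quat (- p) (- q) (- r) (- s)" for p q r s])
  next
    fix x y z :: "'a quat"
    show "x \<oplus>\<^bsub>quaternion_algebra a b\<^esub> y \<oplus>\<^bsub>quaternion_algebra a b\<^esub> z =
          x \<oplus>\<^bsub>quaternion_algebra a b\<^esub> (y \<oplus>\<^bsub>quaternion_algebra a b\<^esub> z)"
      by (cases x; cases y; cases z) (simp add: add.assoc)
    show "x \<oplus>\<^bsub>quaternion_algebra a b\<^esub> y = y \<oplus>\<^bsub>quaternion_algebra a b\<^esub> x"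
      by (cases x; cases y) (simp add: add.commute)
    show "\<zero>\<^bsub>quaternion_algebra a b\<^esub> \<oplus>\<^bsub>quaternion_algebra a b\<^esub> x = x"
      by (cases x) simp
  qed simp_all
  show "Group.monoid (quaternion_algebra a b)"
  proof (rule monoidI)
    fix x y z :: "'a quat"
    show "x \<otimes>\<^bsub>quaternion_algebra a b\<^esub> y \<otimes>\<^bsub>quaternion_algebra a b\<^esub> z =
          x \<otimes>\<^bsub>quaternion_algebra a b\<^esub> (y \<otimes>\<^bsub>quaternion_algebra a b\<^esub> z)"
      by (cases x; cases y; cases z) (simp add: algebra_simps)
    show "\<one>\<^bsub>quaternion_algebra a b\<^esub> \<otimes>\<^bsub>quaternion_algebra a b\<^esub> x = x"
      by (cases x) simp
    show "x \<otimes>\<^bsub>quaternion_algebra a b\<^esub> \<one>\<^bsub>quaternion_algebra a b\<^esub> = x"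
      by (cases x) simp
  qed simp_all
next
  fix x y z :: "'a quat"
  show "(x \<oplus>\<^bsub>quaternion_algebra a b\<^esub> y) \<otimes>\<^bsub>quaternion_algebra a b\<^esub> z =
        x \<otimes>\<^bsub>quaternion_algebra a b\<^esub> z \<oplus>\<^bsub>quaternion_algebra a b\<^esub>
        y \<otimes>\<^bsub>quaternion_algebra a b\<^esub> z"
    by (cases x; cases y; cases z) (simp add: algebra_simps)
  show "z \<otimes>\<^bsub>quaternion_algebra a b\<^esub> (x \<oplus>\<^bsub>quaternion_algebra a b\<^esub> y) =
        z \<otimes>\<^bsub>quaternion_algebra a b\<^esub> x \<oplus>\<^bsub>quaternion_algebra a b\<^esub>
        z \<otimes>\<^bsub>quaternion_algebra a b\<^esub> y"
    by (cases x; cases y; cases z) (simp add: algebra_simps)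
qed

lemma quaternion_relations:
  "quat_mult a b quat_i quat_i = quat_scalar a"
  "quat_mult a b quat_j quat_j = quat_scalar b"
  "quat_mult a b quat_i quat_j = quat_k"
  "quat_add (quat_mult a b quat_i quat_j) (quat_mult a b quat_j quat_i) = quat_scalar 0"
  by simp_all

lemma involution_quat_conj: "involution (quaternion_algebra a b) quat_conj"
  unfolding involution_def
proof (intro conjI ballI)
  fix x y :: "'a quat"
  show "quat_conj (x \<oplus>\<^bsub>quaternion_algebra a b\<^esub> y) =
        quat_conj x \<oplus>\<^bsub>quaternion_algebra a b\<^esub> quat_conj y"
    by (cases x; cases y) simp
  show "quat_conj (x \<otimes>\<^bsub>quaternion_algebra a b\<^esub> y) =
        quat_conj y \<otimes>\<^bsub>quaternion_algebra a b\<^esub> quat_conj x"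
    by (cases x; cases y) (simp add: algebra_simps)
  show "quat_conj (quat_conj x) = x"
    by (cases x) simp
qed simp

lemma ring_hamilton: "ring \<bbbH>"
  unfolding hamilton_quaternions_def by (rule ring_quaternion_algebra)

lemma Units_hamilton: "Units \<bbbH> = carrier \<bbbH> - {\<zero>\<^bsub>\<bbbH>\<^esub>}"
proof (intro equalityI subsetI)
  fix x assume "x \<in> Units \<bbbH>"
  then show "x \<in> carrier \<bbbH> - {\<zero>\<^bsub>\<bbbH>\<^esub>}"
    by (cases x) (auto simp: Units_def hamilton_quaternions_def elim!: quat_mult.elims)
next
  fix x assume x: "x \<in> carrier \<bbbH> - {\<zero>\<^bsub>\<bbbH>\<^esub>}"
  obtain p q r s where xe: "x = Quat p q r s" by (cases x)
  define N where "N = p * p + q * q + r * r + s * s"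
  have "N \<noteq> 0"
  proof
    assume "N = 0"
    moreover have "p * p \<ge> 0" "q * q \<ge> 0" "r * r \<ge> 0" "s * s \<ge> 0" by simp_all
    ultimately have "p * p = 0" "q * q = 0" "r * r = 0" "s * s = 0"
      unfolding N_def by linarith+
    then show False using x xe by (simp add: hamilton_quaternions_def)
  qed
  then have N: "p * p / N + q * q / N + r * r / N + s * s / N = 1"
    by (simp add: N_def flip: add_divide_distrib)
  let ?y = "Quat (p / N) (- q / N) (- r / N) (- s / N)"
  have "quat_mult (-1) (-1) ?y x = quat_scalar 1" "quat_mult (-1) (-1) x ?y = quat_scalar 1"
    using N unfolding xe by (simp_all add: algebra_simps)
  then show "x \<in> Units \<bbbH>"
    unfolding Units_def hamilton_quaternions_def by auto
qed

lemma inv_quat_i_hamilton: "inv\<^bsub>\<bbbH>\<^esub> quat_i = Quat 0 (-1) 0 0"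
proof -
  interpret ring \<bbbH> by (rule ring_hamilton)
  show ?thesis
    by (rule inv_char) (simp_all add: hamilton_quaternions_def)
qed

lemma Int_i_conj_hamilton:
  "(inner_automorphism \<bbbH> quat_i \<circ> quat_conj) (Quat x0 x1 x2 x3) = Quat x0 (- x1) x2 x3"
  by (simp add: inner_automorphism_def inv_quat_i_hamilton)
     (simp add: hamilton_quaternions_def)

lemma line_extension_hamilton:
  "ring.line_extension \<bbbH> (range quat_scalar) v E =
     {quat_add (quat_mult (-1) (-1) (quat_scalar c) v) e | c e. e \<in> E}"
  using ring.line_extension_def[OF ring_hamilton]
  by (auto simp: r_coset_def set_add_def set_mult_def hamilton_quaternions_def)

lemma orthogonal_Int_i_conj_hamilton:
  "orthogonal_involution (range quat_scalar) \<bbbH> (inner_automorphism \<bbbH> quat_i \<circ> quat_conj)"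
proof -
  interpret ring \<bbbH> by (rule ring_hamilton)
  let ?\<sigma> = "inner_automorphism \<bbbH> quat_i \<circ> quat_conj"
  let ?K = "range quat_scalar :: real quat set"
  note step = dimension.Suc_dim[where K = ?K, unfolded line_extension_hamilton]
  have inv: "involution \<bbbH> ?\<sigma>"
    unfolding involution_def
  proof (intro conjI ballI)
    fix x y :: "real quat"
    obtain x0 x1 x2 x3 where x: "x = Quat x0 x1 x2 x3" by (cases x)
    obtain y0 y1 y2 y3 where y: "y = Quat y0 y1 y2 y3" by (cases y)
    show "?\<sigma> (x \<oplus>\<^bsub>\<bbbH>\<^esub> y) = ?\<sigma> x \<oplus>\<^bsub>\<bbbH>\<^esub> ?\<sigma> y"
      unfolding x y Int_i_conj_hamilton
      by (simp add: hamilton_quaternions_def Int_i_conj_hamilton[unfolded hamilton_quaternions_def] del: o_apply)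
    show "?\<sigma> (x \<otimes>\<^bsub>\<bbbH>\<^esub> y) = ?\<sigma> y \<otimes>\<^bsub>\<bbbH>\<^esub> ?\<sigma> x"
      unfolding x y Int_i_conj_hamilton
      by (simp add: hamilton_quaternions_def Int_i_conj_hamilton[unfolded hamilton_quaternions_def]
            algebra_simps del: o_apply)
    show "?\<sigma> (?\<sigma> x) = x"
      unfolding x Int_i_conj_hamilton by simp
  qed (simp add: hamilton_quaternions_def)
  have d1: "dimension (Suc 0) ?K {Quat a 0 0 0 | a. True}"
    using step[OF _ _ zero_dim[of ?K], of "quat_scalar 1"]
    by (simp add: hamilton_quaternions_def)
  have d2: "dimension (Suc (Suc 0)) ?K {Quat a 0 c 0 | a c. True}"
  proof -
    have "{quat_add (quat_mult (-1) (-1) (quat_scalar c) quat_j) e | c e. e \<in> {Quat a 0 0 0 | a. True}}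
            = {Quat a 0 c 0 | a c. True}" by force
    from step[OF _ _ d1, of quat_j, unfolded this] show ?thesis by (simp add: hamilton_quaternions_def)
  qed
  have d3: "dimension (Suc (Suc (Suc 0))) ?K {Quat a 0 c d | a c d. True}"
  proof -
    have "{quat_add (quat_mult (-1) (-1) (quat_scalar c) quat_k) e | c e. e \<in> {Quat a 0 c 0 | a c. True}}
            = {Quat a 0 c d | a c d. True}" by force
    from step[OF _ _ d2, of quat_k, unfolded this] show ?thesis by (simp add: hamilton_quaternions_def)
  qed
  have d4: "dimension (Suc (Suc (Suc (Suc 0)))) ?K UNIV"
  proof -
    have "x \<in> {quat_add (quat_mult (-1) (-1) (quat_scalar c) quat_i) e | c e. e \<in> {Quat a 0 c d | a c d. True}}" for x
      by (cases x) force
    then have "{quat_add (quat_mult (-1) (-1) (quat_scalar c) quat_i) e | c e. e \<in> {Quat a 0 c d | a c d. True}}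
            = UNIV" by blast
    from step[OF _ _ d3, of quat_i, unfolded this] show ?thesis by (simp add: hamilton_quaternions_def)
  qed
  have sym: "{x \<in> carrier \<bbbH>. ?\<sigma> x = x} = {Quat a 0 c d | a c d. True}"
  proof -
    have "?\<sigma> x = x \<longleftrightarrow> x \<in> {Quat a 0 c d | a c d. True}" for x
      by (cases x) (simp add: Int_i_conj_hamilton del: o_apply)
    then show ?thesis by (simp add: hamilton_quaternions_def del: o_apply)
  qed
  have "dimension (2 ^ 2) ?K (carrier \<bbbH>)"
    using d4 by (simp add: hamilton_quaternions_def numeral_eq_Suc)
  moreover have "dimension (2 * (2 + 1) div 2) ?K {x \<in> carrier \<bbbH>. ?\<sigma> x = x}"
  proof -
    have "2 * (2 + 1) div 2 = Suc (Suc (Suc 0))" by simp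
    with d3 show ?thesis unfolding sym by presburger
  qed
  moreover have "\<forall>c\<in>?K. ?\<sigma> c = c"
    using Int_i_conj_hamilton[of _ 0 0 0] by auto
  ultimately show ?thesis
    using inv unfolding orthogonal_involution_def by blast
qed

end

theory Submission
  imports Defs
begin

text \<open>The algebra \<open>\<bbbH>\<close> is a division algebra, and \<open>\<sigma>\<close>
  merely flips the sign of the i-coordinate. If \<open>\<sigma> x\<close> times \<open>x\<close>
  vanishes for a nonzero \<open>x\<close>, then \<open>hamilton_mult_eq_zero_imp\<close> cancels
  \<open>x\<close>, so \<open>\<sigma> x\<close> is zero and hence so is \<open>x\<close>, a
  contradiction. Weak isotropy holds because j, unlike under conjugation, is fixed by
  \<open>\<sigma>\<close>: the value at j is j^2 = -1, which cancels the value 1 at 1.\<close>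

lemma hamilton_mult_eq_zero_imp:
  assumes "x \<otimes>\<^bsub>\<bbbH>\<^esub> y = \<zero>\<^bsub>\<bbbH>\<^esub>" "y \<noteq> \<zero>\<^bsub>\<bbbH>\<^esub>"
  shows "x = \<zero>\<^bsub>\<bbbH>\<^esub>"
proof -
  interpret ring \<bbbH> by (rule ring_hamilton)
  have carrier: "z \<in> carrier \<bbbH>" for z
    by (simp add: hamilton_quaternions_def)
  then have unit: "y \<in> Units \<bbbH>"
    using assms(2) by (simp add: Units_hamilton)
  \<comment> \<open>Right division by \<open>y\<close>, which is a unit by
    \<open>Units_hamilton\<close>; the bracket is zero by assumption.\<close>
  have "x = (x \<otimes>\<^bsub>\<bbbH>\<^esub> y) \<otimes>\<^bsub>\<bbbH>\<^esub> inv\<^bsub>\<bbbH>\<^esub> y"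
    using carrier unit by (simp add: m_assoc)
  also have "\<dots> = \<zero>\<^bsub>\<bbbH>\<^esub>"
    using carrier assms(1) by simp
  finally show ?thesis .
qed

theorem proposition3p11:
  fixes \<sigma> :: "real quat \<Rightarrow> real quat"
  assumes "\<sigma> = inner_automorphism \<bbbH> quat_i \<circ> quat_conj"
  shows "anisotropic \<bbbH> \<sigma> \<and> weakly_isotropic \<bbbH> \<sigma>"
proof
  have \<sigma>: "\<sigma> (Quat a b c d) = Quat a (- b) c d" for a b c d
    unfolding assms by (rule Int_i_conj_hamilton)
  \<comment> \<open>Trivial kernel of \<open>\<sigma>\<close>: this turns the vanishing of the left
    factor \<open>\<sigma> x\<close> into that of \<open>x\<close>.\<close>
  have "x = \<zero>\<^bsub>\<bbbH>\<^esub>" if "\<sigma> x = \<zero>\<^bsub>\<bbbH>\<^esub>" for x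
    using that by (cases x) (simp add: \<sigma> hamilton_quaternions_def)
  then show "anisotropic \<bbbH> \<sigma>"
    unfolding isotropic_def by (blast dest: hamilton_mult_eq_zero_imp)

  interpret ring \<bbbH> by (rule ring_hamilton)
  have carrier: "carrier \<bbbH> = UNIV"
    by (simp add: hamilton_quaternions_def)
  \<comment> \<open>\<open>\<sigma> 1 \<cdot> 1 + \<sigma> j \<cdot> j = 1 + j\<^sup>2 = 0\<close>\<close>
  define x where "x n = (if n = 1 then quat_scalar 1 else quat_j :: real quat)" for n :: nat
  \<comment> \<open>The interval is listed explicitly so that \<open>finsum_insert\<close> can split
    off both terms.\<close>
  have "(\<Oplus>\<^bsub>\<bbbH>\<^esub>n\<in>{1..2}. \<sigma> (x n) \<otimes>\<^bsub>\<bbbH>\<^esub> x n) =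
      (\<Oplus>\<^bsub>\<bbbH>\<^esub>n\<in>{1, 2}. \<sigma> (x n) \<otimes>\<^bsub>\<bbbH>\<^esub> x n)"
    by (rule arg_cong[where f = "finsum \<bbbH> _"]) auto
  also have "\<dots> = \<sigma> (x 1) \<otimes>\<^bsub>\<bbbH>\<^esub> x 1 \<oplus>\<^bsub>\<bbbH>\<^esub> \<sigma> (x 2) \<otimes>\<^bsub>\<bbbH>\<^esub> x 2"
    using carrier by (simp add: finsum_insert Pi_def)
  also have "\<dots> = \<zero>\<^bsub>\<bbbH>\<^esub>"
    by (simp add: x_def \<sigma> hamilton_quaternions_def)
  finally show "weakly_isotropic \<bbbH> \<sigma>"
    unfolding weakly_isotropic_def
    by (intro exI[of _ "2 :: nat"] exI[of _ x] conjI) (auto simp: x_def hamilton_quaternions_def)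
qed

end
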